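(* Let $G$ be a locally finite graph, $r$ a positive integer and $k\ge 2$ an integer. If for every vertex $u\in V(G)$ the ball $G_r(u)$ is $k$-connected, then for every integer $r'>r$ and every vertex $u\in V(G)$ the ball $G_{r'}(u)$ is $k$-connected.
   Context: Graphs have no loops or multiple edges. A graph is locally finite if every vertex has finite degree. For a vertex $u$ of a graph $G$ and an integer $r\ge 0$, $M_r(u)$ is the set of vertices at distance at most $r$ from $u$ in $G$, and the ball $G_r(u)$ of radius $r$ centered at $u$ is the subgraph of $G$ induced by $M_r(u)$. A graph is $k$-connected if the removal of fewer than $k$ vertices results in neither a disconnected graph nor the trivial graph consisting of a single vertex (equivalently, it has more than $k$ vertices and stays connected after deleting any fewer than $k$ vertices). *)

theory Defs
  imports "Graph_Theory.Digraph_Component" "Graph_Theory.Shortest_Path"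
begin

text \<open>
  As in the library's locale \<^locale>\<open>graph\<close>, an undirected simple graph is a symmetric digraph
  without loops and parallel arcs: an edge is a pair of opposite arcs. Unlike \<^locale>\<open>graph\<close>,
  the graph may be infinite. By symmetry, the degree of a vertex is the number of its outgoing arcs.
\<close>

locale locally_finite_graph = sym_digraph + loopfree_digraph + nomulti_digraph +
  assumes finite_out_arcs: "v \<in> verts G \<Longrightarrow> finite (out_arcs G v)"

text \<open>
  With unit weights, \<^const>\<open>wf_digraph.\<mu>\<close> is the infimum of the lengths of all walks from
  \<open>u\<close> to \<open>v\<close>, i.e. the graph distance; it is \<open>\<infinity>\<close> if there is no such walk.
\<close>

definition graph_dist :: "('a, 'b) pre_digraph \<Rightarrow> 'a \<Rightarrow> 'a \<Rightarrow> ereal" where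
  "graph_dist G u v = wf_digraph.\<mu> G (\<lambda>_. 1) u v"

definition ball_verts :: "('a, 'b) pre_digraph \<Rightarrow> nat \<Rightarrow> 'a \<Rightarrow> 'a set" where
  "ball_verts G r u = {v \<in> verts G. graph_dist G u v \<le> ereal (real r)}"

definition graph_ball :: "('a, 'b) pre_digraph \<Rightarrow> nat \<Rightarrow> 'a \<Rightarrow> ('a, 'b) pre_digraph" where
  "graph_ball G r u = G \<restriction> ball_verts G r u"

text \<open>
  The library's \<^const>\<open>Digraph_Component.connected\<close> excludes the graph without
  vertices. For \<open>k \<ge> 1\<close> the following is thus equivalent to having more than \<open>k\<close> vertices and
  staying connected after the removal of fewer than \<open>k\<close> vertices, see \<open>k_connected_iff\<close>.
\<close>

definition k_connected :: "nat \<Rightarrow> ('a, 'b) pre_digraph \<Rightarrow> bool" where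
  "k_connected k G \<longleftrightarrow> (\<forall>S \<subseteq> verts G. finite S \<and> card S < k \<longrightarrow>
     Digraph_Component.connected (G \<restriction> (verts G - S)) \<and> card (verts (G \<restriction> (verts G - S))) \<noteq> 1)"

lemma k_connected_iff:
  assumes "k \<ge> 1"
  shows "k_connected k G \<longleftrightarrow> (infinite (verts G) \<or> k < card (verts G)) \<and>
    (\<forall>S \<subseteq> verts G. finite S \<and> card S < k \<longrightarrow> Digraph_Component.connected (G \<restriction> (verts G - S)))"
proof (intro iffI conjI)
  assume k: "k_connected k G"
  show "\<forall>S \<subseteq> verts G. finite S \<and> card S < k \<longrightarrow> Digraph_Component.connected (G \<restriction> (verts G - S))"
    using k by (simp add: k_connected_def)
  show "infinite (verts G) \<or> k < card (verts G)"
  proof (rule ccontr)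
    assume "\<not> (infinite (verts G) \<or> k < card (verts G))"
    then have fin: "finite (verts G)" and le: "card (verts G) \<le> k" by auto
    have "Digraph_Component.connected (G \<restriction> (verts G - {}))"
      using k assms unfolding k_connected_def by fastforce
    then have "verts G \<noteq> {}" by (simp add: Digraph_Component.connected_def strongly_connected_def)
    then obtain x where x: "x \<in> verts G" by blast
    let ?S = "verts G - {x}"
    have "card ?S < card (verts G)"
      using fin x by (intro psubset_card_mono) auto
    then have "card (verts (G \<restriction> (verts G - ?S))) \<noteq> 1"
      using k fin le unfolding k_connected_def by auto
    moreover have "verts G - ?S = {x}" using x by auto
    ultimately show False by simp
  qed
next
  assume *: "(infinite (verts G) \<or> k < card (verts G)) \<and>
    (\<forall>S \<subseteq> verts G. finite S \<and> card S < k \<longrightarrow> Digraph_Component.connected (G \<restriction> (verts G - S)))"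
  show "k_connected k G"
    unfolding k_connected_def
  proof (intro allI impI conjI)
    fix S assume S: "S \<subseteq> verts G" "finite S \<and> card S < k"
    show "Digraph_Component.connected (G \<restriction> (verts G - S))" using * S by blast
    show "card (verts (G \<restriction> (verts G - S))) \<noteq> 1"
    proof (cases "finite (verts G)")
      case True
      then have "card (verts G - S) = card (verts G) - card S" "k < card (verts G)"
        using * S by (auto simp: card_Diff_subset)
      then have "card (verts G - S) > 1" using S by linarith
      then show ?thesis by simp
    next
      case False
      then have "infinite (verts G - S)" using S by simp
      then show ?thesis by simp
    qed
  qed
qed

end

theory Submission
  imports Defs
begin

text \<open>
  By induction it suffices to pass from radius \<open>r\<close> to radius \<open>r + 1\<close>. The ball of radius
  \<open>r + 1\<close> around \<open>u\<close> is covered by the balls of radius \<open>r\<close> around \<open>u\<close> and its neighbours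
  (\<open>ball_verts_Suc\<close>). Delete a set \<open>S\<close> of fewer than \<open>k\<close> vertices. What remains of each small
  ball is connected, so it is enough that what remains of the ball around a neighbour \<open>v\<close>
  still meets what remains of the ball around \<open>u\<close> (\<open>connected_star_union\<close>).

  Since \<open>r \<ge> 1\<close>, the vertex \<open>v\<close> lies in the ball of radius \<open>r\<close> around \<open>u\<close>, which is
  \<open>k\<close>-connected, so \<open>v\<close> has at least \<open>k\<close> neighbours in it (\<open>k_connected_min_degree\<close>). As
  neighbours of \<open>v\<close> they also belong to the ball around \<open>v\<close>, and \<open>S\<close> cannot contain all of
  them.
\<close>

section \<open>Balls\<close>

text \<open>
  The infimum in the definition of the distance is over natural numbers, so it is at most
  \<open>n\<close> only if some walk has length below \<open>n + 1\<close>.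
\<close>

lemma (in wf_digraph) graph_dist_le_iff:
  "graph_dist G u v \<le> ereal (real n) \<longleftrightarrow> (\<exists>p. awalk u p v \<and> length p \<le> n)"
proof -
  have cost: "awalk_cost (\<lambda>_. 1) p = real (length p)" for p :: "'b list"
    by (induction p) auto
  show ?thesis
  proof
    assume "graph_dist G u v \<le> ereal (real n)"
    also have "\<dots> < ereal (real (Suc n))" by simp
    finally obtain p where "awalk u p v" "ereal (awalk_cost (\<lambda>_. 1) p) < ereal (real (Suc n))"
      unfolding graph_dist_def \<mu>_def Inf_less_iff by auto
    then show "\<exists>p. awalk u p v \<and> length p \<le> n"
      unfolding cost by auto
  next
    assume "\<exists>p. awalk u p v \<and> length p \<le> n"
    then obtain p where "awalk u p v" "length p \<le> n" by blast
    then show "graph_dist G u v \<le> ereal (real n)"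
      using min_cost_le_walk_cost[of u p v "\<lambda>_. 1"] unfolding graph_dist_def cost
      by (meson ereal_less_eq(3) of_nat_le_iff order_trans)
  qed
qed

lemma (in wf_digraph) ball_verts_iff_awalk:
  "v \<in> ball_verts G n u \<longleftrightarrow> (\<exists>p. awalk u p v \<and> length p \<le> n)"
  unfolding ball_verts_def graph_dist_le_iff by auto

lemma (in wf_digraph) ball_verts_Suc:
  "ball_verts G (Suc n) u = ball_verts G n u \<union> (\<Union>v \<in> {v. u \<rightarrow>\<^bsub>G\<^esub> v}. ball_verts G n v)"
proof (intro set_eqI iffI)
  fix w assume "w \<in> ball_verts G (Suc n) u"
  then obtain p where p: "awalk u p w" "length p \<le> Suc n"
    by (auto simp: ball_verts_iff_awalk)
  show "w \<in> ball_verts G n u \<union> (\<Union>v \<in> {v. u \<rightarrow>\<^bsub>G\<^esub> v}. ball_verts G n v)"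
  proof (cases p)
    case Nil
    then show ?thesis using p by (auto simp: ball_verts_iff_awalk)
  next
    case (Cons e q)
    then have "u \<rightarrow>\<^bsub>G\<^esub> head G e" "awalk (head G e) q w" "length q \<le> n"
      using p by (auto simp: awalk_Cons_iff intro: in_arcs_imp_in_arcs_ends)
    then show ?thesis by (auto simp: ball_verts_iff_awalk)
  qed
next
  fix w assume "w \<in> ball_verts G n u \<union> (\<Union>v \<in> {v. u \<rightarrow>\<^bsub>G\<^esub> v}. ball_verts G n v)"
  then consider "w \<in> ball_verts G n u" | v where "u \<rightarrow>\<^bsub>G\<^esub> v" "w \<in> ball_verts G n v"
    by blast
  then show "w \<in> ball_verts G (Suc n) u"
  proof cases
    case 1
    then show ?thesis by (auto simp: ball_verts_iff_awalk intro: le_SucI)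
  next
    case 2
    then obtain e p where "e \<in> arcs G" "tail G e = u" "head G e = v" "awalk v p w" "length p \<le> n"
      by (auto simp: ball_verts_iff_awalk)
    then have "awalk u (e # p) w" "length (e # p) \<le> Suc n"
      by (auto simp: awalk_Cons_iff)
    then show ?thesis unfolding ball_verts_iff_awalk by blast
  qed
qed

lemma (in wf_digraph) neighbour_in_ball_verts:
  assumes "u \<rightarrow>\<^bsub>G\<^esub> v" "n \<ge> 1"
  shows "v \<in> ball_verts G n u"
proof -
  obtain e where "e \<in> arcs G" "tail G e = u" "head G e = v" using assms by auto
  then have "awalk u [e] v" by (auto simp: awalk_simps)
  with assms(2) show ?thesis unfolding ball_verts_iff_awalk by force
qed

section \<open>Connectivity of induced subgraphs\<close>

lemma induce_subgraph_twice: "B \<subseteq> A \<Longrightarrow> (G \<restriction> A) \<restriction> B = G \<restriction> B"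
  by (auto simp: induce_subgraph_def)

lemma k_connected_induce_iff:
  "k_connected k (G \<restriction> A) \<longleftrightarrow> (\<forall>S \<subseteq> A. finite S \<and> card S < k \<longrightarrow>
     Digraph_Component.connected (G \<restriction> (A - S)) \<and> card (A - S) \<noteq> 1)"
  by (simp add: k_connected_def induce_subgraph_twice)

lemma (in sym_digraph) connected_induce_iff:
  assumes "A \<subseteq> verts G"
  shows "Digraph_Component.connected (G \<restriction> A) \<longleftrightarrow>
    A \<noteq> {} \<and> (\<forall>x\<in>A. \<forall>y\<in>A. x \<rightarrow>\<^sup>*\<^bsub>G \<restriction> A\<^esub> y)"
proof -
  have ind: "induced_subgraph (G \<restriction> A) G" using assms by (rule induced_induce)
  interpret A: wf_digraph "G \<restriction> A" using ind by (rule wf_digraphI_induced)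
  have "symmetric (G \<restriction> A)" using sym_arcs ind by (rule induced_graph_imp_symmetric)
  then show ?thesis
    by (simp add: Digraph_Component.connected_def strongly_connected_def A.reachable_mk_symmetric_eq)
qed

text \<open>
  Any vertex of the union reaches the central set \<open>C\<close> inside its own member of the family,
  and two vertices are then joined through \<open>C\<close>.
\<close>

lemma (in sym_digraph) connected_star_union:
  assumes C: "C \<subseteq> verts G" "Digraph_Component.connected (G \<restriction> C)"
    and A: "\<And>i. i \<in> I \<Longrightarrow> A i \<subseteq> verts G"
      "\<And>i. i \<in> I \<Longrightarrow> Digraph_Component.connected (G \<restriction> A i)"
      "\<And>i. i \<in> I \<Longrightarrow> A i \<inter> C \<noteq> {}"
  shows "Digraph_Component.connected (G \<restriction> (C \<union> (\<Union>i\<in>I. A i)))"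
proof -
  let ?U = "C \<union> (\<Union>i\<in>I. A i)"
  have U: "?U \<subseteq> verts G" using C A by blast
  have ind: "induced_subgraph (G \<restriction> ?U) G" using U by (rule induced_induce)
  interpret U: wf_digraph "G \<restriction> ?U" using ind by (rule wf_digraphI_induced)
  have sym: "symmetric (G \<restriction> ?U)" using sym_arcs ind by (rule induced_graph_imp_symmetric)
  obtain c where c: "c \<in> C" using C by (auto simp: connected_induce_iff)
  have in_C: "x \<rightarrow>\<^sup>*\<^bsub>G \<restriction> ?U\<^esub> y" if "x \<in> C" "y \<in> C" for x y
    using that C connected_induce_iff[OF C(1)] by (blast intro: reachable_induce_ss)
  have to_c: "x \<rightarrow>\<^sup>*\<^bsub>G \<restriction> ?U\<^esub> c" if "x \<in> ?U" for x
  proof (cases "x \<in> C")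
    case True
    then show ?thesis using c by (rule in_C)
  next
    case False
    then obtain i where i: "i \<in> I" "x \<in> A i" using \<open>x \<in> ?U\<close> by blast
    then obtain y where y: "y \<in> A i" "y \<in> C" using A(3) by blast
    have "x \<rightarrow>\<^sup>*\<^bsub>G \<restriction> A i\<^esub> y" using i y A connected_induce_iff[of "A i"] by blast
    then have "x \<rightarrow>\<^sup>*\<^bsub>G \<restriction> ?U\<^esub> y" using i by (blast intro: reachable_induce_ss)
    then show ?thesis using in_C[OF y(2) c] by (rule U.reachable_trans)
  qed
  have "x \<rightarrow>\<^sup>*\<^bsub>G \<restriction> ?U\<^esub> y" if "x \<in> ?U" "y \<in> ?U" for x y
    using to_c[OF that(1)] symmetric_reachable[OF sym to_c[OF that(2)]]
    by (rule U.reachable_trans)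
  then show ?thesis unfolding connected_induce_iff[OF U] using c by blast
qed

text \<open>
  Fewer than \<open>k\<close> neighbours could be deleted. This would isolate \<open>v\<close>, although the rest of a
  \<open>k\<close>-connected graph is connected and has a vertex other than \<open>v\<close>.
\<close>

lemma (in sym_digraph) k_connected_min_degree:
  assumes kc: "k_connected k (G \<restriction> A)"
    and A: "A \<subseteq> verts G" "v \<in> A" and loopfree: "\<not> v \<rightarrow>\<^bsub>G\<^esub> v"
    and N: "finite {w \<in> A. v \<rightarrow>\<^bsub>G\<^esub> w}"
  shows "k \<le> card {w \<in> A. v \<rightarrow>\<^bsub>G\<^esub> w}"
proof (rule ccontr)
  let ?N = "{w \<in> A. v \<rightarrow>\<^bsub>G\<^esub> w}"
  assume "\<not> k \<le> card ?N"
  then have con: "Digraph_Component.connected (G \<restriction> (A - ?N))" and card: "card (A - ?N) \<noteq> 1"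
    using kc N unfolding k_connected_induce_iff by auto
  have v: "v \<in> A - ?N" using A loopfree by blast
  have "A - ?N \<noteq> {v}" using card by fastforce
  then obtain x where x: "x \<in> A - ?N" "x \<noteq> v" using v by blast
  have "v \<rightarrow>\<^sup>*\<^bsub>G \<restriction> (A - ?N)\<^esub> x"
    using con v x A connected_induce_iff[of "A - ?N"] by blast
  then obtain w where "v \<rightarrow>\<^bsub>G \<restriction> (A - ?N)\<^esub> w"
    using x(2) by (cases rule: pre_digraph.converse_reachable_cases) auto
  then have "w \<in> A - ?N" "v \<rightarrow>\<^bsub>G\<^esub> w" by (auto dest: dominates_induce_subgraphD)
  then show False by blast
qed

section \<open>Enlarging the radius\<close>

lemma k_connected_graph_ball_Suc:
  assumes G: "sym_digraph G" "loopfree_digraph G" and "r \<ge> 1"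
    and balls: "\<And>u. u \<in> verts G \<Longrightarrow> k_connected k (graph_ball G r u)"
    and u: "u \<in> verts G"
  shows "k_connected k (graph_ball G (Suc r) u)"
  unfolding graph_ball_def k_connected_induce_iff
proof (intro allI impI)
  interpret sym_digraph G by (rule G(1))
  interpret loopfree_digraph G by (rule G(2))
  let ?M = "ball_verts G r"
  fix S assume S: "S \<subseteq> ball_verts G (Suc r) u" "finite S \<and> card S < k"
  have M_verts: "?M v \<subseteq> verts G" for v by (auto simp: ball_verts_def)
  have small: "Digraph_Component.connected (G \<restriction> (?M v - S)) \<and> card (?M v - S) \<noteq> 1"
    if "v \<in> verts G" for v
  proof -
    have "finite (?M v \<inter> S)" "card (?M v \<inter> S) < k"
      using S(2) card_mono[of S "?M v \<inter> S"] by auto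
    then have "Digraph_Component.connected (G \<restriction> (?M v - ?M v \<inter> S)) \<and> card (?M v - ?M v \<inter> S) \<noteq> 1"
      using balls[OF that] unfolding graph_ball_def k_connected_induce_iff by blast
    then show ?thesis by (simp add: Diff_Int)
  qed
  have meet: "(?M v - S) \<inter> (?M u - S) \<noteq> {}" if uv: "u \<rightarrow>\<^bsub>G\<^esub> v" for v
  proof
    let ?N = "{w \<in> ?M u. v \<rightarrow>\<^bsub>G\<^esub> w}"
    assume "(?M v - S) \<inter> (?M u - S) = {}"
    moreover have "?N \<subseteq> ?M v" using neighbour_in_ball_verts \<open>r \<ge> 1\<close> by blast
    ultimately have N: "?N \<subseteq> S" by blast
    then have "finite ?N" using S(2) finite_subset by blast
    moreover have "v \<in> ?M u" using uv \<open>r \<ge> 1\<close> by (rule neighbour_in_ball_verts)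
    moreover have "\<not> v \<rightarrow>\<^bsub>G\<^esub> v" using adj_not_same by blast
    ultimately have "k \<le> card ?N"
      using k_connected_min_degree balls[OF u] M_verts unfolding graph_ball_def by blast
    also have "\<dots> \<le> card S" using N S(2) by (simp add: card_mono)
    finally show False using S(2) by simp
  qed
  have cover: "ball_verts G (Suc r) u - S = (?M u - S) \<union> (\<Union>v \<in> {v. u \<rightarrow>\<^bsub>G\<^esub> v}. ?M v - S)"
    unfolding ball_verts_Suc by blast
  show "Digraph_Component.connected (G \<restriction> (ball_verts G (Suc r) u - S)) \<and>
    card (ball_verts G (Suc r) u - S) \<noteq> 1"
  proof
    show "Digraph_Component.connected (G \<restriction> (ball_verts G (Suc r) u - S))"
      unfolding cover
    proof (rule connected_star_union)
      show "?M u - S \<subseteq> verts G" using M_verts by blast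
      show "Digraph_Component.connected (G \<restriction> (?M u - S))" using small[OF u] by blast
      fix v assume v: "v \<in> {v. u \<rightarrow>\<^bsub>G\<^esub> v}"
      show "?M v - S \<subseteq> verts G" using M_verts by blast
      show "Digraph_Component.connected (G \<restriction> (?M v - S))"
        using small[of v] v adj_in_verts(2) by blast
      show "(?M v - S) \<inter> (?M u - S) \<noteq> {}" using meet v by blast
    qed
    \<comment> \<open>A one-element superset would equal its nonempty subset \<open>?M u - S\<close>.\<close>
    show "card (ball_verts G (Suc r) u - S) \<noteq> 1"
    proof
      assume "card (ball_verts G (Suc r) u - S) = 1"
      then obtain x where x: "ball_verts G (Suc r) u - S = {x}" by (auto simp: card_1_singleton_iff)
      have "?M u - S \<noteq> {}"
        using small[OF u] connected_induce_iff[of "?M u - S"] M_verts[of u] by blast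
      moreover have "?M u - S \<subseteq> {x}" using cover x by blast
      ultimately have "?M u - S = {x}" by blast
      then show False using small[OF u] by simp
    qed
  qed
qed

theorem theorem4p1:
  fixes G :: "('a, 'b) pre_digraph" and r k :: nat
  assumes "locally_finite_graph G"
    and "r \<ge> 1"
    and "k \<ge> 2"
    and "\<forall>u \<in> verts G. k_connected k (graph_ball G r u)"
  shows "\<forall>r' > r. \<forall>u \<in> verts G. k_connected k (graph_ball G r' u)"
proof (intro allI impI)
  interpret locally_finite_graph G by (rule assms(1))
  fix r' assume "r < r'"
  then have "r \<le> r'" by simp
  then show "\<forall>u \<in> verts G. k_connected k (graph_ball G r' u)"
  proof (induction r' rule: dec_induct)
    case base
    show ?case by (rule assms(4))
  next
    case (step n)
    have "n \<ge> 1" using step.hyps assms(2) by simp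
    then show ?case
      using k_connected_graph_ball_Suc[of G n k] sym_digraph_axioms loopfree_digraph_axioms step.IH
      by blast
  qed
qed

end
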